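(* Let $X\subseteq Y$ be sets, and let $<^X$ be a linear order on $X$ and $<^Y$ a linear order on $Y$, both of order type $\omega$, such that $<^X$ and $<^Y|_X$ almost agree. Then there is a linear order $\lessdot^Y$ on $Y$ of order type $\omega$ such that $\lessdot^Y$ almost agrees with $<^Y$ and $\lessdot^Y|_X=<^X$.
   Context: Two linear orders $<^1,<^2$ on a set $Z$ almost agree if there is a finite $Z_0\subseteq Z$ such that $<^1$ and $<^2$ coincide on $Z\setminus Z_0$. For $X\subseteq Y$, $<^Y|_X$ denotes the restriction of $<^Y$ to $X$. *)

theory Defs
  imports Main
begin

text \<open>Orders are strict relations. The library's \<^const>\<open>strict_linear_order_on\<close> leaves the
  relation unconstrained outside the set, so containment in \<open>A \<times> A\<close> is added; this makes
  equality of orders on \<open>A\<close> mean equality of relations.\<close>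

definition lin_order_on :: "'a set \<Rightarrow> 'a rel \<Rightarrow> bool" where
  "lin_order_on A r \<longleftrightarrow> r \<subseteq> A \<times> A \<and> strict_linear_order_on A r"

definition order_type_omega :: "'a set \<Rightarrow> 'a rel \<Rightarrow> bool" where
  "order_type_omega A r \<longleftrightarrow>
     (\<exists>f :: nat \<Rightarrow> 'a. bij_betw f UNIV A \<and> (\<forall>m n. m < n \<longleftrightarrow> (f m, f n) \<in> r))"

definition almost_agree :: "'a set \<Rightarrow> 'a rel \<Rightarrow> 'a rel \<Rightarrow> bool" where
  "almost_agree Z r s \<longleftrightarrow>
     (\<exists>Z0. finite Z0 \<and> Z0 \<subseteq> Z \<and> Restr r (Z - Z0) = Restr s (Z - Z0))"

end

theory Submission
  imports Defs "HOL-Library.Infinite_Set"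
begin

text \<open>Let \<open>I\<close> be a finite initial segment of \<open>X\<close> with respect to \<open>rX\<close> that contains the
  finitely many points on which \<open>rX\<close> and \<open>rY\<close> may disagree. Order \<open>I\<close> by \<open>rX\<close>, order \<open>Y - I\<close>
  by \<open>rY\<close>, and put \<open>I\<close> in front: only the finite set \<open>I\<close> has been moved, and on \<open>X - I\<close> the
  two given orders coincide.\<close>

definition move_to_front :: "'a set \<Rightarrow> 'a rel \<Rightarrow> 'a set \<Rightarrow> 'a rel \<Rightarrow> 'a rel" where
  "move_to_front I r Y s = Restr r I \<union> I \<times> (Y - I) \<union> Restr s (Y - I)"

text \<open>Linearity is transported from \<open><\<close> on the natural numbers along the
  enumeration. The order constructed later therefore only has to be shown to have order type omega
  and to lie inside \<open>Y \<times> Y\<close>.\<close>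

lemma order_type_omega_imp_lin_order_on:
  assumes "r \<subseteq> A \<times> A" and "order_type_omega A r"
  shows "lin_order_on A r"
proof -
  obtain f :: "nat \<Rightarrow> 'a" where f: "bij_betw f UNIV A" "\<And>m n. m < n \<longleftrightarrow> (f m, f n) \<in> r"
    using assms(2) unfolding order_type_omega_def by blast
  have surj: "\<exists>n. a = f n" if "a \<in> A" for a
    using f(1) that unfolding bij_betw_def by auto
  have "trans r"
  proof (rule transI)
    fix a b c assume *: "(a, b) \<in> r" "(b, c) \<in> r"
    then have "a \<in> A" "b \<in> A" "c \<in> A" using assms(1) by auto
    then obtain k m n where "a = f k" "b = f m" "c = f n" using surj by metis
    with * show "(a, c) \<in> r" using f(2) less_trans by metis
  qed
  moreover have "irrefl r"
    unfolding irrefl_def using assms(1) surj f(2) by (metis less_irrefl mem_Sigma_iff subsetD)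
  moreover have "total_on A r"
    unfolding total_on_def using surj f(2) by (metis nat_neq_iff)
  ultimately show ?thesis
    using assms(1) unfolding lin_order_on_def strict_linear_order_on_def by blast
qed

text \<open>Deleting finitely many points from an omega-sequence leaves an omega-sequence, and
  putting a block of length \<open>k\<close> in front of it keeps the type, since k + omega =
  omega.\<close>

lemma order_type_omega_move_to_front:
  assumes f: "inj f" "\<And>m n. m < n \<longleftrightarrow> (f m, f n) \<in> r"
    and I: "I = f ` {..<k :: nat}" "I \<subseteq> Y"
    and Y: "order_type_omega Y s"
  shows "order_type_omega Y (move_to_front I r Y s)"
proof -
  obtain g :: "nat \<Rightarrow> 'a" where g: "bij_betw g UNIV Y" "\<And>m n. m < n \<longleftrightarrow> (g m, g n) \<in> s"
    using Y unfolding order_type_omega_def by blast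
  define N where "N = {n. g n \<notin> I}"
  have "finite I" using I(1) by simp
  then have "finite (g -` I)"
    using g(1) by (intro finite_vimageI) (auto simp: bij_betw_def)
  moreover have "N = - (g -` I)" unfolding N_def by auto
  ultimately have N: "infinite N" by (metis finite_compl infinite_UNIV_nat)
  have gN: "bij_betw g N (Y - I)"
    using g(1) unfolding N_def bij_betw_def inj_on_def by auto
  \<comment> \<open>\<open>enumerate N\<close> lists the indices of the surviving points
    increasingly, so \<open>e\<close> lists \<open>Y - I\<close> in the order
    \<open>s\<close>.\<close>
  define e where "e = (\<lambda>n. g (enumerate N n))"
  have e: "bij_betw e UNIV (Y - I)"
    using bij_betw_trans[OF bij_enumerate[OF N] gN] by (simp add: e_def comp_def)
  have e_less: "(e m, e n) \<in> s \<longleftrightarrow> m < n" for m n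
    using N g(2) unfolding e_def by (metis enumerate_mono_iff)
  define h where "h = (\<lambda>n. if n < k then f n else e (n - k))"
  have fI: "f n \<in> I \<longleftrightarrow> n < k" for n
    using f(1) I(1) by (auto dest: injD)
  have eI: "e n \<in> Y" "e n \<notin> I" for n
    using bij_betwE[OF e] by auto
  \<comment> \<open>Comparing \<open>m\<close> and \<open>n\<close> with \<open>k\<close> decides
    which of the three pieces of the union can contain the pair.\<close>
  have h_less: "m < n \<longleftrightarrow> (h m, h n) \<in> move_to_front I r Y s" for m n
    using fI[of m] fI[of n] eI f(2)[of m n]
    by (auto simp: h_def move_to_front_def e_less)
  \<comment> \<open>If \<open>h m = h n\<close> with \<open>m < n\<close>, then \<open>h m\<close>
    is related to itself, and \<open>h_less\<close> gives \<open>m < m\<close>.\<close>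
  then have "inj h" unfolding inj_on_def by (metis less_irrefl nat_neq_iff)
  moreover have "range h = Y"
  proof
    show "range h \<subseteq> Y" using fI eI(1) I(2) by (auto simp: h_def)
    show "Y \<subseteq> range h"
    proof
      fix y assume "y \<in> Y"
      show "y \<in> range h"
      proof (cases "y \<in> I")
        case True
        then obtain n where "n < k" "y = f n" using I(1) by auto
        then have "y = h n" by (simp add: h_def)
        then show ?thesis by blast
      next
        case False
        with \<open>y \<in> Y\<close> obtain n where "y = e n" using e unfolding bij_betw_def by blast
        then have "y = h (k + n)" by (simp add: h_def)
        then show ?thesis by blast
      qed
    qed
  qed
  ultimately show ?thesis
    unfolding order_type_omega_def bij_betw_def using h_less by blast
qed

theorem lemmaA3:
  fixes X Y :: "'a set" and rX rY :: "'a rel"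
  assumes "X \<subseteq> Y"
    and "lin_order_on X rX" and "order_type_omega X rX"
    and "lin_order_on Y rY" and "order_type_omega Y rY"
    and "almost_agree X rX (Restr rY X)"
  shows "\<exists>sY. lin_order_on Y sY \<and> order_type_omega Y sY \<and>
           almost_agree Y sY rY \<and> Restr sY X = rX"
proof -
  obtain f :: "nat \<Rightarrow> 'a" where f: "bij_betw f UNIV X" "\<And>m n. m < n \<longleftrightarrow> (f m, f n) \<in> rX"
    using assms(3) unfolding order_type_omega_def by blast
  obtain Z where Z: "finite Z" "Z \<subseteq> X" "Restr rX (X - Z) = Restr (Restr rY X) (X - Z)"
    using assms(6) unfolding almost_agree_def by blast
  have inj: "inj f" and ran: "range f = X" using f(1) unfolding bij_betw_def by auto
  have "finite (f -` Z)" using Z(1) inj by (rule finite_vimageI)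
  then obtain k where k: "\<And>n. f n \<in> Z \<Longrightarrow> n < k"
    using finite_nat_bounded by (metis lessThan_iff subsetD vimageI)
  \<comment> \<open>Since \<open>f\<close> lists \<open>X\<close> increasingly, this image is an
    initial segment of \<open>rX\<close>; the choice of \<open>k\<close> makes it contain
    \<open>Z\<close>.\<close>
  define I where "I = f ` {..<k}"
  have "Z \<subseteq> I" using Z(2) ran k unfolding I_def by blast
  have "I \<subseteq> X" using ran unfolding I_def by auto
  let ?s = "move_to_front I rX Y rY"
  have omega: "order_type_omega Y ?s"
    using order_type_omega_move_to_front[OF inj f(2) I_def _ assms(5)] \<open>I \<subseteq> X\<close> assms(1) by blast
  have "?s \<subseteq> Y \<times> Y"
    using \<open>I \<subseteq> X\<close> assms(1) unfolding move_to_front_def by blast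
  then have lin: "lin_order_on Y ?s"
    using omega by (rule order_type_omega_imp_lin_order_on)
  have "finite I" "I \<subseteq> Y" using \<open>I \<subseteq> X\<close> assms(1) by (auto simp: I_def)
  moreover have "Restr ?s (Y - I) = Restr rY (Y - I)"
    unfolding move_to_front_def by blast
  ultimately have agree: "almost_agree Y ?s rY"
    unfolding almost_agree_def by blast
  \<comment> \<open>The first conjunct matches the block \<open>I \<times> (Y - I)\<close>; the
    second excludes pairs leading from \<open>X - I\<close> back into \<open>I\<close>, which
    \<open>?s\<close> does not have.\<close>
  have initial: "(a, b) \<in> rX \<and> (b, a) \<notin> rX" if ab: "a \<in> I" "b \<in> X - I" for a b
  proof -
    obtain m where "m < k" "a = f m" using ab(1) I_def by auto
    moreover obtain n where "b = f n" using ab(2) ran by auto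
    moreover have "k \<le> n" using ab(2) \<open>b = f n\<close> unfolding I_def by (auto simp: not_less)
    ultimately show ?thesis using f(2)[of m n] f(2)[of n m] by auto
  qed
  have tail: "(a, b) \<in> rX \<longleftrightarrow> (a, b) \<in> rY" if "a \<in> X - I" "b \<in> X - I" for a b
    using Z(3) that \<open>Z \<subseteq> I\<close> by blast
  \<comment> \<open>Pairs inside \<open>I\<close> agree by construction, mixed pairs by
    \<open>initial\<close>, and pairs outside \<open>I\<close> by \<open>tail\<close>.\<close>
  have "Restr ?s X = rX"
  proof (rule set_eqI, clarify)
    fix a b
    have "rX \<subseteq> X \<times> X" using assms(2) unfolding lin_order_on_def by blast
    then show "(a, b) \<in> Restr ?s X \<longleftrightarrow> (a, b) \<in> rX"
      using initial[of a b] initial[of b a] tail[of a b] \<open>I \<subseteq> X\<close> assms(1)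
      unfolding move_to_front_def by blast
  qed
  with lin omega agree show ?thesis by blast
qed

end
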